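(* Every orbit type $T$ has only finitely many equivalence classes under $\equiv_c$.
   Context: **Orbit types.** Let $G_0$ be a reflection group $*332$, $*432$, $*532$ or $*22m$ ($m\ge2$) in $\mathbb{R}^3$ (orbifold notation), generated by reflections $r_1,r_2,r_3$ whose mirrors bound a fundamental domain: for $*332$, mirrors $x=y$, $x=-y$, $y=z$; for $*432$, mirrors $x=0$, $x=y$, $y=z$; for $*532$, mirrors $x=0$, $y=0$, $\phi x+y-\phi^{-1}z=0$ with $\phi=(1+\sqrt5)/2$; for $*22m$, mirrors $z=0$, $y=0$, and the plane through the $z$-axis at angle $\pi/m$ to $y=0$. Let $u_i$ be the vector in the closed fundamental domain lying on the two mirrors other than that of $r_i$, at distance 1 from the mirror of $r_i$. For $N$ a point group that is a normal subgroup of $G_0$, let $V_N(a,b,c)$ be the $N$-orbit of the generating point $au_1+bu_2+cu_3$. An orbit type $T$ is one of the families $V_N(a,b,1)$, $V_N(0,a,1)$, $V_N(a,0,1)$, $V_N(a,1,0)$, $V_N(0,0,1)$, $V_N(0,1,0)$, $V_N(1,0,0)$, with the parameters $a,b$ ranging over the positive reals (identical families are identified; families whose members are coplanar point sets are discarded). For $V,U\in T$ with generating points $p_V,p_U$, the canonical mapping $f:V\to U$ is the unique map with $f(g(p_V))=g(p_U)$ for all $g\in G$, where $G$ is any point group acting transitively on all members of $T$. **The relation $\equiv_c$.** All members of $T$ have the same number $k$ of points; enumerate each by a bijection $i_T:V\to\{1,\dots,k\}$ preserved by the canonical mappings. The volume configuration $\operatorname{Conf}_V:\{1,\dots,k\}^4\to\mathbb{R}$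 sends $(i_T(v_0),\dots,i_T(v_3))$ to the determinant of the $4\times4$ matrix with rows $(v_{jx},v_{jy},v_{jz},1)$, $j=0,1,2,3$; its values are called entries. Write $V\ge_c U$ if whenever an entry of $\operatorname{Conf}_U$ is $0$, the corresponding entry (same index tuple) of $\operatorname{Conf}_V$ is also $0$; write $V\equiv_c U$ if $V\ge_c U$ and $U\ge_c V$. *)

theory Defs
  imports "HOL-Analysis.Analysis" "HOL-Algebra.Generated_Groups"
begin

section \<open>Point groups\<close>

definition O3 :: "(real^3 \<Rightarrow> real^3) monoid" where
  "O3 = \<lparr>carrier = {f. orthogonal_transformation f}, mult = (\<circ>), one = id\<rparr>"

definition point_group :: "(real^3 \<Rightarrow> real^3) set \<Rightarrow> bool" where
  "point_group G \<longleftrightarrow> subgroup G O3 \<and> finite G"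

definition orb :: "(real^3 \<Rightarrow> real^3) set \<Rightarrow> real^3 \<Rightarrow> (real^3) set" where
  "orb G p = (\<lambda>g. g p) ` G"

definition transitive_on :: "(real^3 \<Rightarrow> real^3) set \<Rightarrow> (real^3) set \<Rightarrow> bool" where
  "transitive_on G V \<longleftrightarrow> (\<forall>v\<in>V. orb G v = V)"


section \<open>The reflection groups *332, *432, *532 and *22m\<close>

datatype refl_type = Star332 | Star432 | Star532 | Star22 nat

fun valid_type :: "refl_type \<Rightarrow> bool" where
  "valid_type (Star22 m) \<longleftrightarrow> m \<ge> 2"
| "valid_type _ \<longleftrightarrow> True"

definition golden :: real where
  "golden = (1 + sqrt 5) / 2"

text \<open>
  Row \<open>i\<close> is a normal of the mirror of \<open>r\<^sub>i\<close>. Three mirrors cut space into eight regions; the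
  signs are chosen such that the normals point into a fundamental domain, i.e. such that the angle
  inside the region between mirrors with product of order \<open>n\<close> is \<open>\<pi>/n\<close>. Explicitly, the domains
  are \<open>\<bar>x\<bar> \<le> y \<le> z\<close> for *332, \<open>0 \<le> x \<le> y \<le> z\<close> for *432,
  \<open>x \<ge> 0\<close>, \<open>y \<ge> 0\<close>, \<open>\<phi> x + y \<le> \<phi>\<^sup>-\<^sup>1 z\<close> for *532, and the wedge \<open>z \<ge> 0\<close>,
  polar angle between \<open>0\<close> and \<open>\<pi>/m\<close> for *22m. Any other fundamental domain with
  the same mirrors is congruent to this one.
\<close>

fun normals :: "refl_type \<Rightarrow> real^3^3" where
  "normals Star332 = vector [vector [-1, 1, 0], vector [1, 1, 0], vector [0, -1, 1]]"
| "normals Star432 = vector [vector [1, 0, 0], vector [-1, 1, 0], vector [0, -1, 1]]"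
| "normals Star532 = vector [vector [1, 0, 0], vector [0, 1, 0],
                             vector [-golden, -1, inverse golden]]"
| "normals (Star22 m) = vector [vector [0, 0, 1], vector [0, 1, 0],
                                vector [sin (pi / real m), - cos (pi / real m), 0]]"

definition mirror :: "refl_type \<Rightarrow> 3 \<Rightarrow> (real^3) set" where
  "mirror t i = {x. normals t $ i \<bullet> x = 0}"

definition refl :: "refl_type \<Rightarrow> 3 \<Rightarrow> real^3 \<Rightarrow> real^3" where
  "refl t i x = (let n = normals t $ i in x - (2 * (n \<bullet> x) / (n \<bullet> n)) *\<^sub>R n)"

definition refl_group :: "refl_type \<Rightarrow> (real^3 \<Rightarrow> real^3) set" where
  "refl_group t = generate O3 (range (refl t))"

definition fund_domain :: "refl_type \<Rightarrow> (real^3) set" where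
  "fund_domain t = {x. \<forall>i. normals t $ i \<bullet> x \<ge> 0}"

definition u_vec :: "refl_type \<Rightarrow> 3 \<Rightarrow> real^3" where
  "u_vec t i = (THE u. u \<in> fund_domain t \<and> (\<forall>j. j \<noteq> i \<longrightarrow> u \<in> mirror t j) \<and>
                       infdist u (mirror t i) = 1)"


section \<open>Orbit types and canonical mappings\<close>

definition gen_point :: "refl_type \<Rightarrow> real \<times> real \<times> real \<Rightarrow> real^3" where
  "gen_point t = (\<lambda>(a, b, c). a *\<^sub>R u_vec t 1 + b *\<^sub>R u_vec t 2 + c *\<^sub>R u_vec t 3)"

definition param_families :: "(real \<times> real \<times> real) set set" where
  "param_families =
    {{(a, b, 1) |a b. a > 0 \<and> b > 0},
     {(0, a, 1) |a. a > 0}, {(a, 0, 1) |a. a > 0}, {(a, 1, 0) |a. a > 0},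
     {(0, 0, 1)}, {(0, 1, 0)}, {(1, 0, 0)}}"

text \<open>
  An orbit type \<open>T\<close> is a set of point sets, so identical families are automatically identified.
  It comes with the function \<open>p\<close> choosing for each member its generating point; this is unique
  for given \<open>t\<close>, \<open>N\<close> and \<open>P\<close> because the fundamental domain meets each orbit of the reflection
  group in a single point.
\<close>

definition orbit_type :: "(real^3) set set \<Rightarrow> ((real^3) set \<Rightarrow> real^3) \<Rightarrow> bool" where
  "orbit_type T p \<longleftrightarrow>
    (\<exists>t N P. valid_type t \<and>
       point_group N \<and> N \<lhd> O3\<lparr>carrier := refl_group t\<rparr> \<and>
       P \<in> param_families \<and>
       T = (\<lambda>q. orb N (gen_point t q)) ` P \<and>
       (\<forall>V\<in>T. p V \<in> gen_point t ` P \<and> V = orb N (p V)) \<and>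
       \<not> (\<forall>V\<in>T. coplanar V))"

text \<open>
  The condition is imposed for every point group \<open>G\<close> acting transitively on all members of \<open>T\<close>.
  The group \<open>N\<close> of the orbit type is one of them, which gives uniqueness. The conditions for different
  \<open>G\<close> are compatible: the parameter range is connected and the stabilizers in \<open>N\<close> of all
  generating points of a family agree, so for each \<open>g \<in> G\<close> there is one \<open>n \<in> N\<close> with
  \<open>g (p V) = n (p V)\<close> for all \<open>V\<close> in \<open>T\<close>.
\<close>

definition canonical_map ::
  "(real^3) set set \<Rightarrow> ((real^3) set \<Rightarrow> real^3) \<Rightarrow> (real^3) set \<Rightarrow> (real^3) set \<Rightarrow> real^3 \<Rightarrow> real^3"
where
  "canonical_map T p V U =
    (THE f. f \<in> V \<rightarrow>\<^sub>E U \<and>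
       (\<forall>G. point_group G \<and> (\<forall>W\<in>T. transitive_on G W) \<longrightarrow> (\<forall>g\<in>G. f (g (p V)) = g (p U))))"

definition enumeration ::
  "(real^3) set set \<Rightarrow> ((real^3) set \<Rightarrow> real^3) \<Rightarrow> nat \<Rightarrow> ((real^3) set \<Rightarrow> real^3 \<Rightarrow> nat) \<Rightarrow> bool"
where
  "enumeration T p k \<iota> \<longleftrightarrow>
    (\<forall>V\<in>T. bij_betw (\<iota> V) V {1..k}) \<and>
    (\<forall>V\<in>T. \<forall>U\<in>T. \<forall>v\<in>V. \<iota> U (canonical_map T p V U v) = \<iota> V v)"


section \<open>Volume configurations\<close>

definition hom_row :: "real^3 \<Rightarrow> real^4" where
  "hom_row v = vector [v $ 1, v $ 2, v $ 3, 1]"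

definition Conf ::
  "((real^3) set \<Rightarrow> real^3 \<Rightarrow> nat) \<Rightarrow> (real^3) set \<Rightarrow> nat \<times> nat \<times> nat \<times> nat \<Rightarrow> real"
where
  "Conf \<iota> V = (\<lambda>(j0, j1, j2, j3).
     let v = inv_into V (\<iota> V)
     in det (vector [hom_row (v j0), hom_row (v j1), hom_row (v j2), hom_row (v j3)] :: real^4^4))"

definition conf_ge ::
  "nat \<Rightarrow> ((real^3) set \<Rightarrow> real^3 \<Rightarrow> nat) \<Rightarrow> (real^3) set \<Rightarrow> (real^3) set \<Rightarrow> bool"
where
  "conf_ge k \<iota> V U \<longleftrightarrow>
    (\<forall>j \<in> {1..k} \<times> {1..k} \<times> {1..k} \<times> {1..k}. Conf \<iota> U j = 0 \<longrightarrow> Conf \<iota> V j = 0)"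

definition conf_equiv ::
  "(real^3) set set \<Rightarrow> nat \<Rightarrow> ((real^3) set \<Rightarrow> real^3 \<Rightarrow> nat) \<Rightarrow> ((real^3) set \<times> (real^3) set) set"
where
  "conf_equiv T k \<iota> = {(V, U). V \<in> T \<and> U \<in> T \<and> conf_ge k \<iota> V U \<and> conf_ge k \<iota> U V}"

end

theory Submission
  imports Defs
begin

text \<open>
  Up to \<open>\<equiv>\<^sub>c\<close>, a member of the orbit type is known as soon as the positions of the zero entries of
  its volume configuration are known, because \<open>\<ge>\<^sub>c\<close> is inclusion between these sets of positions.
  As all members have the same number \<open>k\<close> of points, the positions lie in one finite set of \<open>k\<^sup>4\<close>
  index tuples, which has only finitely many subsets.
\<close>

definition zero_positions ::
  "nat \<Rightarrow> ((real^3) set \<Rightarrow> real^3 \<Rightarrow> nat) \<Rightarrow> (real^3) set \<Rightarrow> (nat \<times> nat \<times> nat \<times> nat) set"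
where
  "zero_positions k \<iota> V = {j \<in> {1..k} \<times> {1..k} \<times> {1..k} \<times> {1..k}. Conf \<iota> V j = 0}"

lemma conf_ge_iff_zero_positions_subset:
  "conf_ge k \<iota> V U \<longleftrightarrow> zero_positions k \<iota> U \<subseteq> zero_positions k \<iota> V"
  unfolding conf_ge_def zero_positions_def by blast

lemma conf_equiv_eq_kernel_zero_positions:
  "conf_equiv T k \<iota> = {(V, U). V \<in> T \<and> U \<in> T \<and> zero_positions k \<iota> V = zero_positions k \<iota> U}"
  unfolding conf_equiv_def conf_ge_iff_zero_positions_subset by blast

text \<open>Each class of the kernel of \<open>f\<close> on \<open>A\<close> is the fibre of \<open>f\<close> over one of its values.\<close>

lemma finite_quotient_kernel:
  assumes "finite (f ` A)"
  shows "finite (A // {(x, y). x \<in> A \<and> y \<in> A \<and> f x = f y})"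
proof -
  let ?r = "{(x, y). x \<in> A \<and> y \<in> A \<and> f x = f y}"
  have "A // ?r \<subseteq> (\<lambda>z. {y \<in> A. f y = z}) ` f ` A"
  proof
    fix X assume "X \<in> A // ?r"
    then obtain x where x: "x \<in> A" and X: "X = ?r `` {x}"
      by (rule quotientE)
    from x have "X = {y \<in> A. f y = f x}"
      unfolding X by auto
    with x show "X \<in> (\<lambda>z. {y \<in> A. f y = z}) ` f ` A"
      by blast
  qed
  with assms show ?thesis
    by (meson finite_imageI finite_subset)
qed

theorem theorem3p23:
  fixes T :: "(real^3) set set"
    and p :: "(real^3) set \<Rightarrow> real^3"
    and k :: nat
    and \<iota> :: "(real^3) set \<Rightarrow> real^3 \<Rightarrow> nat"
  assumes "orbit_type T p"
    and "enumeration T p k \<iota>"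
  shows "finite (T // conf_equiv T k \<iota>)"
proof -
  have "zero_positions k \<iota> ` T \<subseteq> Pow ({1..k} \<times> {1..k} \<times> {1..k} \<times> {1..k})"
    unfolding zero_positions_def by blast
  then have "finite (zero_positions k \<iota> ` T)"
    by (rule finite_subset) simp
  then show ?thesis
    unfolding conf_equiv_eq_kernel_zero_positions by (rule finite_quotient_kernel)
qed

end
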